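(* Let $\mathcal{O}$ be the binary octahedral group. The group $\mathcal{O}\times\mathcal{O}$ is exceptional with distinguished quotient the central product $\mathcal{O}\circ\mathcal{O}$, and $\mu(\mathcal{O}\circ\mathcal{O})=48$.
   Context: For a finite group $G$, $\mu(G)$ denotes the minimal faithful permutation degree of $G$: the least non-negative integer $m$ such that $G$ embeds in $\mathrm{Sym}(m)$. A finite group $G$ is exceptional if it has a normal subgroup $N$ with $\mu(G/N)>\mu(G)$; then $G/N$ is called a distinguished quotient and $N$ a distinguished subgroup. In the real quaternions $\mathbb{H}$, let $Q_8=\{\pm1,\pm i,\pm j,\pm k\}$, $\omega=\frac12(-1+i+j+k)$ and $\gamma=\frac{1}{\sqrt2}(1+i)$. The binary tetrahedral group is $\mathcal{T}=Q_8\langle\omega\rangle$ (order $24$) and the binary octahedral group is $\mathcal{O}=\mathcal{T}\langle\gamma\rangle$ (order $48$), generated by $\omega$ and $\gamma$, with centre $\{\pm1\}$. The central product of a group $G$ with itself is $G\circ G=(G\times G)/\{(z,z): z\in Z(G)\}$; here $\mathcal{O}\circ\mathcal{O}=(\mathcal{O}\times\mathcal{O})/\langle(-1,-1)\rangle$. *)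

theory Defs
  imports Complex_Main "HOL-Algebra.Algebra"
begin

section \<open>Minimal faithful permutation degree and exceptional groups\<close>

definition min_perm_degree :: "('a, 'b) monoid_scheme \<Rightarrow> nat"
  where "min_perm_degree G = (LEAST m. mon G (sym_group m) \<noteq> {})"

definition distinguished_subgroup :: "'a set \<Rightarrow> ('a, 'b) monoid_scheme \<Rightarrow> bool"
  where "distinguished_subgroup N G \<longleftrightarrow>
    N \<lhd> G \<and> min_perm_degree (G Mod N) > min_perm_degree G"

definition distinguished_quotient :: "'a set monoid \<Rightarrow> ('a, 'b) monoid_scheme \<Rightarrow> bool"
  where "distinguished_quotient Q G \<longleftrightarrow> (\<exists>N. distinguished_subgroup N G \<and> Q = G Mod N)"

definition exceptional :: "('a, 'b) monoid_scheme \<Rightarrow> bool"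
  where "exceptional G \<longleftrightarrow>
    group G \<and> finite (carrier G) \<and> (\<exists>N. distinguished_subgroup N G)"


section \<open>Centre and central product of a group with itself\<close>

definition group_centre :: "('a, 'b) monoid_scheme \<Rightarrow> 'a set"
  where "group_centre G =
    {z \<in> carrier G. \<forall>x \<in> carrier G. z \<otimes>\<^bsub>G\<^esub> x = x \<otimes>\<^bsub>G\<^esub> z}"

definition central_square :: "('a, 'b) monoid_scheme \<Rightarrow> ('a \<times> 'a) set monoid"
  where "central_square G = (G \<times>\<times> G) Mod {(z, z) | z. z \<in> group_centre G}"


section \<open>The real quaternions\<close>

text \<open>\<open>Quat a b c d\<close> stands for $a + bi + cj + dk$.\<close>

datatype quat = Quat (qRe: real) (qI: real) (qJ: real) (qK: real)

instantiation quat :: division_ring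
begin

definition zero_quat :: quat where "0 = Quat 0 0 0 0"

definition one_quat :: quat where "1 = Quat 1 0 0 0"

definition plus_quat :: "quat \<Rightarrow> quat \<Rightarrow> quat" where
  "p + q = Quat (qRe p + qRe q) (qI p + qI q) (qJ p + qJ q) (qK p + qK q)"

definition uminus_quat :: "quat \<Rightarrow> quat" where
  "- p = Quat (- qRe p) (- qI p) (- qJ p) (- qK p)"

definition minus_quat :: "quat \<Rightarrow> quat \<Rightarrow> quat" where
  "p - q = Quat (qRe p - qRe q) (qI p - qI q) (qJ p - qJ q) (qK p - qK q)"

definition times_quat :: "quat \<Rightarrow> quat \<Rightarrow> quat" where
  "p * q = Quat
    (qRe p * qRe q - qI p * qI q - qJ p * qJ q - qK p * qK q)
    (qRe p * qI q + qI p * qRe q + qJ p * qK q - qK p * qJ q)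
    (qRe p * qJ q - qI p * qK q + qJ p * qRe q + qK p * qI q)
    (qRe p * qK q + qI p * qJ q - qJ p * qI q + qK p * qRe q)"

definition inverse_quat :: "quat \<Rightarrow> quat" where
  "inverse p = (let n = (qRe p)\<^sup>2 + (qI p)\<^sup>2 + (qJ p)\<^sup>2 + (qK p)\<^sup>2
    in Quat (qRe p / n) (- qI p / n) (- qJ p / n) (- qK p / n))"

definition divide_quat :: "quat \<Rightarrow> quat \<Rightarrow> quat" where
  "p div q = p * inverse (q :: quat)"

lemma quat_norm_sq_neq_0:
  assumes "p \<noteq> (0 :: quat)"
  shows "(qRe p)\<^sup>2 + (qI p)\<^sup>2 + (qJ p)\<^sup>2 + (qK p)\<^sup>2 \<noteq> 0"
  using assms
  by (cases p) (auto simp: zero_quat_def add_nonneg_eq_0_iff)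

instance
proof
  fix a b c :: quat
  show "a * b * c = a * (b * c)"
    by (simp add: times_quat_def algebra_simps)
  show "(a + b) * c = a * c + b * c" "a * (b + c) = a * b + a * c"
    by (simp_all add: times_quat_def plus_quat_def algebra_simps)
  show "a \<noteq> 0 \<Longrightarrow> inverse a * a = 1" "a \<noteq> 0 \<Longrightarrow> a * inverse a = 1"
    using quat_norm_sq_neq_0[of a]
    by (simp_all add: times_quat_def inverse_quat_def one_quat_def Let_def
        add_divide_distrib[symmetric] diff_divide_distrib[symmetric]
        power2_eq_square algebra_simps)
qed (simp_all add: zero_quat_def one_quat_def plus_quat_def uminus_quat_def minus_quat_def
    times_quat_def inverse_quat_def divide_quat_def quat.expand)

end

definition quat_i :: quat where "quat_i = Quat 0 1 0 0"

definition quat_j :: quat where "quat_j = Quat 0 0 1 0"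

definition quat_k :: quat where "quat_k = Quat 0 0 0 1"

lemma quat_units_mult:
  "quat_i * quat_i = - 1" "quat_j * quat_j = - 1" "quat_k * quat_k = - 1"
  "quat_i * quat_j = quat_k" "quat_j * quat_k = quat_i" "quat_k * quat_i = quat_j"
  by (simp_all add: quat_i_def quat_j_def quat_k_def times_quat_def one_quat_def uminus_quat_def)

definition quat_mult_group :: "quat monoid"
  where "quat_mult_group = \<lparr>carrier = UNIV - {0}, monoid.mult = (*), one = 1\<rparr>"

lemma group_quat_mult_group: "group quat_mult_group"
proof (rule groupI)
  fix x assume "x \<in> carrier quat_mult_group"
  then show "\<exists>y\<in>carrier quat_mult_group. y \<otimes>\<^bsub>quat_mult_group\<^esub> x = \<one>\<^bsub>quat_mult_group\<^esub>"
    by (intro bexI[of _ "inverse x"]) (simp_all add: quat_mult_group_def)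
qed (simp_all add: quat_mult_group_def mult.assoc)


section \<open>The binary polyhedral groups\<close>

definition Q8 :: "quat set"
  where "Q8 = {1, - 1, quat_i, - quat_i, quat_j, - quat_j, quat_k, - quat_k}"

definition quat_omega :: quat
  where "quat_omega = Quat (- 1 / 2) (1 / 2) (1 / 2) (1 / 2)"

definition quat_gamma :: quat
  where "quat_gamma = Quat (1 / sqrt 2) (1 / sqrt 2) 0 0"

definition binary_tetrahedral :: "quat monoid"
  where "binary_tetrahedral = subgroup_generated quat_mult_group (Q8 \<union> {quat_omega})"

definition binary_octahedral :: "quat monoid"
  where "binary_octahedral =
    subgroup_generated quat_mult_group (carrier binary_tetrahedral \<union> {quat_gamma})"

text \<open>Consistency with the other standard descriptions: the group is generated by
  \<open>quat_omega\<close> and \<open>quat_gamma\<close>, and its centre consists of the two scalars.\<close>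

lemma group_binary_octahedral: "group binary_octahedral"
  unfolding binary_octahedral_def
  by (rule group.group_subgroup_generated[OF group_quat_mult_group])

lemma quat_mult_group_simps [simp]:
  "carrier quat_mult_group = UNIV - {0}"
  "x \<otimes>\<^bsub>quat_mult_group\<^esub> y = x * y"
  "\<one>\<^bsub>quat_mult_group\<^esub> = 1"
  by (simp_all add: quat_mult_group_def)

lemma binary_octahedral_mult [simp]: "x \<otimes>\<^bsub>binary_octahedral\<^esub> y = x * y"
  by (simp add: binary_octahedral_def subgroup_generated_def)

lemma carrier_binary_octahedral:
  "carrier binary_octahedral = generate quat_mult_group {quat_omega, quat_gamma}"
proof -
  let ?H = quat_mult_group
  let ?S = "generate ?H {quat_omega, quat_gamma}"
  interpret group ?H by (rule group_quat_mult_group)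
  note defs = quat_i_def quat_j_def quat_k_def quat_omega_def quat_gamma_def
    zero_quat_def one_quat_def uminus_quat_def times_quat_def
  have gens: "{quat_omega, quat_gamma} \<subseteq> carrier ?H"
    by (auto simp: defs)
  have Q8T: "Q8 \<union> {quat_omega} \<subseteq> carrier ?H"
    by (auto simp: Q8_def defs)
  have T: "carrier binary_tetrahedral = generate ?H (Q8 \<union> {quat_omega})"
    using Q8T by (simp only: binary_tetrahedral_def carrier_subgroup_generated Int_absorb1)
  have T_sub: "carrier binary_tetrahedral \<subseteq> carrier ?H"
    unfolding T using generate_incl[OF Q8T] .
  have O: "carrier binary_octahedral = generate ?H (carrier binary_tetrahedral \<union> {quat_gamma})"
    using T_sub gens by (simp only: binary_octahedral_def carrier_subgroup_generated Int_absorb1 Un_least insert_subset)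
  have S: "subgroup ?S ?H" by (rule generate_is_subgroup[OF gens])
  have w: "quat_omega \<in> ?S" and g: "quat_gamma \<in> ?S"
    by (auto intro: generate.incl)
  have m: "x * y \<in> ?S" if "x \<in> ?S" "y \<in> ?S" for x y
    using subgroup.m_closed[OF S that] by simp
  have i: "quat_i = quat_gamma * quat_gamma"
    by (simp add: defs field_simps)
  have j: "quat_j = quat_omega * (quat_omega * (quat_i * quat_omega))"
    by (simp add: defs field_simps)
  have iS: "quat_i \<in> ?S" unfolding i by (intro m g)
  have jS: "quat_j \<in> ?S" unfolding j by (intro m w iS)
  have kS: "quat_k \<in> ?S" using m[OF iS jS] by (simp add: quat_units_mult)
  have nS: "- 1 \<in> ?S" using m[OF iS iS] by (simp add: quat_units_mult)
  have "1 \<in> ?S" using subgroup.one_closed[OF S] by simp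
  then have "Q8 \<union> {quat_omega} \<subseteq> ?S"
    using iS jS kS nS w m[OF nS iS] m[OF nS jS] m[OF nS kS] by (simp add: Q8_def)
  then have "carrier binary_tetrahedral \<union> {quat_gamma} \<subseteq> ?S"
    unfolding T using generate_subgroup_incl[OF _ S] g by auto
  then have "carrier binary_octahedral \<subseteq> ?S"
    unfolding O by (rule generate_subgroup_incl[OF _ S])
  moreover have "?S \<subseteq> carrier binary_octahedral"
    unfolding O by (rule mono_generate) (auto simp: T intro: generate.incl)
  ultimately show ?thesis by blast
qed

lemma group_centre_binary_octahedral: "group_centre binary_octahedral = {1, - 1}"
proof -
  let ?H = quat_mult_group
  let ?S = "generate ?H {quat_omega, quat_gamma}"
  interpret group ?H by (rule group_quat_mult_group)
  note defs = quat_omega_def quat_gamma_def zero_quat_def one_quat_def uminus_quat_def times_quat_def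
  have gens: "{quat_omega, quat_gamma} \<subseteq> carrier ?H"
    by (auto simp: defs)
  have S: "subgroup ?S ?H" by (rule generate_is_subgroup[OF gens])
  have w: "quat_omega \<in> ?S" and g: "quat_gamma \<in> ?S"
    by (auto intro: generate.incl)
  have m: "x * y \<in> ?S" if "x \<in> ?S" "y \<in> ?S" for x y
    using subgroup.m_closed[OF S that] by simp
  have one: "1 \<in> ?S" using subgroup.one_closed[OF S] by simp
  have "- 1 = (quat_gamma * quat_gamma) * (quat_gamma * quat_gamma)"
    by (simp add: defs field_simps)
  then have minus: "- 1 \<in> ?S" using m[OF m[OF g g] m[OF g g]] by simp
  define N where "N = {x :: quat. (qRe x)\<^sup>2 + (qI x)\<^sup>2 + (qJ x)\<^sup>2 + (qK x)\<^sup>2 = 1}"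
  have N_mult: "x * y \<in> N" if "x \<in> N" "y \<in> N" for x y
  proof -
    have "(qRe (x * y))\<^sup>2 + (qI (x * y))\<^sup>2 + (qJ (x * y))\<^sup>2 + (qK (x * y))\<^sup>2
      = ((qRe x)\<^sup>2 + (qI x)\<^sup>2 + (qJ x)\<^sup>2 + (qK x)\<^sup>2) * ((qRe y)\<^sup>2 + (qI y)\<^sup>2 + (qJ y)\<^sup>2 + (qK y)\<^sup>2)"
      by (simp add: times_quat_def power2_eq_square algebra_simps)
    then show ?thesis using that by (simp add: N_def)
  qed
  have N: "subgroup N ?H"
  proof (rule subgroupI)
    show "N \<subseteq> carrier ?H" by (auto simp: N_def zero_quat_def)
    show "N \<noteq> {}" by (auto simp: N_def intro!: exI[of _ 1] simp: one_quat_def)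
    fix x assume x: "x \<in> N"
    then have "x \<noteq> 0" by (auto simp: N_def zero_quat_def)
    then have "inv\<^bsub>?H\<^esub> x = inverse x" by (intro inv_equality) auto
    with x show "inv\<^bsub>?H\<^esub> x \<in> N" by (simp add: N_def inverse_quat_def Let_def)
  qed (simp add: N_mult)
  have "{quat_omega, quat_gamma} \<subseteq> N"
    by (simp add: N_def defs power2_eq_square)
  then have SN: "?S \<subseteq> N" by (rule generate_subgroup_incl[OF _ N])
  have "z \<in> {1, - 1}"
    if z: "z \<in> ?S" and zw: "z * quat_omega = quat_omega * z" and zg: "z * quat_gamma = quat_gamma * z" for z
  proof -
    have JK: "qJ z = 0" "qK z = 0"
      using zg by (simp_all add: defs)
    with zw have I: "qI z = 0" by (simp add: defs)
    have "(qRe z)\<^sup>2 = 1" using SN z JK I by (auto simp: N_def)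
    then have "qRe z = 1 \<or> qRe z = - 1" by (simp add: power2_eq_1_iff)
    then show ?thesis using I JK by (cases z) (auto simp: one_quat_def uminus_quat_def)
  qed
  then show ?thesis
    using one minus w g unfolding group_centre_def carrier_binary_octahedral
    by auto
qed

end

theory Submission
  imports Defs
begin

text \<open>
  Write \<open>O\<close> for the binary octahedral group. The degree of \<open>O \<times> O\<close> is small
  because the subgroup \<open>{1, \<omega>, \<omega>\<^sup>2}\<close> and its conjugate by \<open>\<gamma>\<close> meet only in 1: the 16 cosets
  of that subgroup carry a faithful action of \<open>O\<close>, and two copies of them carry a faithful action of \<open>O \<times> O\<close>
  on 32 points (\<open>direct_square_embeds_in_sym_32\<close>). The central square acts faithfully on the
  48 elements of \<open>O\<close> by \<open>x \<mapsto> a x b\<^sup>-\<^sup>1\<close>, because the pairs \<open>(a, b)\<close> that act trivially are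
  exactly the \<open>(z, z)\<close> with \<open>z\<close> central (\<open>central_square_embeds_in_sym_48\<close>).

  That 48 points are necessary is a statement about subgroups. In a faithful permutation
  representation of the central square, the class of \<open>(1, -1)\<close> moves some point \<open>s\<close>. The
  stabiliser of \<open>s\<close> in \<open>O \<times> O\<close> is a subgroup \<open>K\<close> that contains \<open>(-1, -1)\<close> but not \<open>(1, -1)\<close>.
  Such a subgroup has at most 48 elements (\<open>subgroup_product_card_le_48\<close>), so the orbit
  of \<open>s\<close> has at least \<open>48 * 48 / 48 = 48\<close> points.

  The bound on \<open>K\<close> is an argument in the style of Goursat. Put \<open>A = {a. (a, 1) \<in> K}\<close> and
  \<open>B = {b. (1, b) \<in> K}\<close>, and let \<open>P\<close> be the second projection of \<open>K\<close>. Neither \<open>A\<close> nor \<open>B\<close>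
  contains \<open>-1\<close>. Since \<open>-1\<close> is the only involution of \<open>O\<close>, they have odd order, and an odd
  divisor of 48 is at most 3. If \<open>B\<close> is trivial, then \<open>K\<close> embeds in \<open>O\<close> by the first
  projection. Otherwise \<open>P\<close> normalises a nontrivial \<open>B\<close>. If \<open>P\<close> had more than 16 elements, its
  index would be at most 2 and it would contain all squares, in particular \<open>i\<close> and \<open>j\<close>. The
  commutators of \<open>i\<close> and \<open>j\<close> with elements of \<open>B\<close> lie in the trivial group \<open>Q\<^sub>8 \<inter> B\<close>,
  because \<open>Q\<^sub>8\<close> is normal in \<open>O\<close>; so \<open>B\<close> would consist of real quaternions and be trivial
  after all. Hence \<open>P\<close> has at most 16 elements (\<open>normaliser_card_le_16\<close>), and \<open>K\<close> has at most
  \<open>16 * 3 = 48\<close>.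

  The order 48 itself comes from the chain that starts with \<open>Q\<^sub>8\<close>, adjoins \<open>\<omega>\<close>, of order 3
  modulo \<open>Q\<^sub>8\<close>, and then \<open>\<gamma>\<close>, of order 2 modulo the binary tetrahedral group
  (\<open>cyclic_extension\<close>).
\<close>


section \<open>Counting in finite groups\<close>

text \<open>
  Left multiplication by an element of the set is injective, hence onto the finite set, so
  the identity is attained and provides the inverse.
\<close>

lemma (in group) finite_closed_subgroup:
  assumes "finite U" "U \<subseteq> carrier G" "\<one> \<in> U" "\<And>x y. \<lbrakk>x \<in> U; y \<in> U\<rbrakk> \<Longrightarrow> x \<otimes> y \<in> U"
  shows "subgroup U G"
proof (rule subgroupI)
  fix x assume x: "x \<in> U"
  then have xG: "x \<in> carrier G" using assms(2) by blast
  have "inj_on ((\<otimes>) x) U"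
    using inj_on_cmult[OF xG] assms(2) by (rule inj_on_subset)
  then have "(\<otimes>) x ` U = U"
    using assms(1,4) x by (intro endo_inj_surj) auto
  then obtain y where y: "y \<in> U" "x \<otimes> y = \<one>" using assms(3) by (metis imageE)
  then have "y \<in> carrier G" using assms(2) by blast
  then have "inv x = y" using xG y inv_equality inv_comm by simp
  with y show "inv x \<in> U" by simp
qed (use assms in auto)

text \<open>
  A normal form for the group obtained by adjoining to \<open>A\<close> an element that normalises it. It
  yields both the elements and the order of the two binary polyhedral groups.
\<close>

lemma (in group) cyclic_extension:
  fixes n :: nat
  assumes A: "subgroup A G" "finite A" and g: "g \<in> carrier G"
    and normal: "\<And>a. a \<in> A \<Longrightarrow> \<exists>a'\<in>A. a \<otimes> g = g \<otimes> a'"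
    and n: "n > 0" "g [^] n \<in> A" "\<And>k. \<lbrakk>0 < k; k < n\<rbrakk> \<Longrightarrow> g [^] k \<notin> A"
  shows "generate G (insert g A) = (\<lambda>(k, a). g [^] k \<otimes> a) ` ({..<n} \<times> A)"
    and "card (generate G (insert g A)) = n * card A"
proof -
  interpret A: subgroup A G by fact
  let ?f = "\<lambda>(k :: nat, a). g [^] k \<otimes> a"
  let ?U = "?f ` ({..<n} \<times> A)"
  have AG: "a \<in> carrier G" if "a \<in> A" for a using that by (rule A.mem_carrier)
  have normal_pow: "\<exists>a'\<in>A. a \<otimes> g [^] k = g [^] k \<otimes> a'" if "a \<in> A" for a and k :: nat
    using that
  proof (induction k arbitrary: a)
    case 0 then show ?case using AG by auto
  next
    case (Suc k)
    then obtain a1 where a1: "a1 \<in> A" "a \<otimes> g [^] k = g [^] k \<otimes> a1" by blast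
    then obtain a2 where a2: "a2 \<in> A" "a1 \<otimes> g = g \<otimes> a2" using normal by blast
    have "a \<otimes> g [^] Suc k = (a \<otimes> g [^] k) \<otimes> g" using AG Suc.prems g by (simp add: m_assoc)
    also have "\<dots> = g [^] k \<otimes> (a1 \<otimes> g)" using a1 AG g by (simp add: m_assoc)
    also have "\<dots> = g [^] Suc k \<otimes> a2" using a2 AG g by (simp add: m_assoc)
    finally show ?case using a2 by blast
  qed
  have pow_mult_n: "g [^] (n * q) \<in> A" for q :: nat
    by (induction q) (use n(2) g in \<open>auto simp: nat_pow_mult[symmetric]\<close>)
  \<comment> \<open>exponents may be reduced modulo \<open>n\<close>, since powers with exponent a multiple of \<open>n\<close> lie in \<open>A\<close>\<close>
  have reduce: "g [^] k \<otimes> a \<in> ?U" if a: "a \<in> A" for a and k :: nat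
  proof -
    have "g [^] k = g [^] (k mod n) \<otimes> g [^] (n * (k div n))"
      using g by (simp add: nat_pow_mult)
    then have "g [^] k \<otimes> a = g [^] (k mod n) \<otimes> (g [^] (n * (k div n)) \<otimes> a)"
      using g a AG by (simp add: m_assoc)
    moreover have "g [^] (n * (k div n)) \<otimes> a \<in> A" using pow_mult_n a by blast
    ultimately show ?thesis using n(1) by (intro image_eqI[of _ _ "(k mod n, g [^] (n * (k div n)) \<otimes> a)"]) auto
  qed
  have "subgroup ?U G"
  proof (rule finite_closed_subgroup)
    show "finite ?U" using A(2) by simp
    show "?U \<subseteq> carrier G" using g AG by auto
    show "\<one> \<in> ?U" using reduce[OF A.one_closed, of 0] by simp
    fix x y assume "x \<in> ?U" "y \<in> ?U"
    then obtain k l :: nat and a b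
      where x: "a \<in> A" "x = g [^] k \<otimes> a" and y: "b \<in> A" "y = g [^] l \<otimes> b"
      by auto
    obtain a' where a': "a' \<in> A" "a \<otimes> g [^] l = g [^] l \<otimes> a'" using normal_pow x by blast
    have "x \<otimes> y = g [^] k \<otimes> (a \<otimes> g [^] l) \<otimes> b" using x y AG g by (simp add: m_assoc)
    also have "\<dots> = g [^] (k + l) \<otimes> (a' \<otimes> b)"
      unfolding a' using a' x y AG g by (simp add: m_assoc nat_pow_mult[symmetric])
    finally show "x \<otimes> y \<in> ?U" using reduce a'(1) y(1) by simp
  qed
  moreover have "insert g A \<subseteq> ?U"
    using reduce[OF A.one_closed, of 1] reduce[of _ 0] g AG by auto
  ultimately have "generate G (insert g A) \<subseteq> ?U" by (rule generate_subgroup_incl[rotated])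
  moreover have "?U \<subseteq> generate G (insert g A)"
  proof -
    have S: "subgroup (generate G (insert g A)) G"
      using g A.subset by (intro generate_is_subgroup) auto
    have mem: "x \<in> insert g A \<Longrightarrow> x \<in> generate G (insert g A)" for x by (rule generate.incl)
    then have "g [^] k \<in> generate G (insert g A)" for k :: nat
      by (induction k) (auto intro: subgroup.one_closed[OF S] subgroup.m_closed[OF S])
    then show ?thesis using mem by (auto intro: subgroup.m_closed[OF S])
  qed
  ultimately show eq: "generate G (insert g A) = ?U" by blast
  have key: "\<not> k < l" if "k < n" "l < n" "a \<in> A" "b \<in> A" "g [^] k \<otimes> a = g [^] l \<otimes> b"
    for k l :: nat and a b
  proof
    assume "k < l"
    then have "g [^] l = g [^] k \<otimes> g [^] (l - k)" using g by (simp add: nat_pow_mult)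
    then have "a = g [^] (l - k) \<otimes> b" using that AG g by (simp add: m_assoc)
    then have "g [^] (l - k) = a \<otimes> inv b" using that AG g by (simp add: m_assoc)
    then have "g [^] (l - k) \<in> A" using that by simp
    moreover have "0 < l - k" "l - k < n" using \<open>k < l\<close> \<open>l < n\<close> by simp_all
    ultimately show False using n(3) by blast
  qed
  have "inj_on ?f ({..<n} \<times> A)"
  proof (rule inj_onI, clarsimp)
    fix k l :: nat and a b
    assume h: "k < n" "a \<in> A" "l < n" "b \<in> A" "g [^] k \<otimes> a = g [^] l \<otimes> b"
    then have "k = l" using key[of k l a b] key[of l k b a] by simp
    with h show "k = l \<and> a = b" using AG g by simp
  qed
  then show "card (generate G (insert g A)) = n * card A"
    unfolding eq by (simp add: card_image card_cartesian_product)
qed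

text \<open>
  This covers at once the orbit-stabiliser bound, where \<open>f\<close> evaluates at a point and \<open>S\<close> is
  its stabiliser, and the bound of a group by the image and the kernel of a projection.
\<close>

lemma (in group) subgroup_card_le_by_fibres:
  assumes K: "subgroup K G" and fin: "finite K" "finite Y" and f: "f ` K \<subseteq> Y"
    and fibre: "\<And>g h. \<lbrakk>g \<in> K; h \<in> K; f g = f h\<rbrakk> \<Longrightarrow> inv g \<otimes> h \<in> S"
    and S: "finite S"
  shows "card K \<le> card Y * card S"
proof -
  interpret K: subgroup K G by fact
  have fibre_card: "card {h \<in> K. f h = y} \<le> card S" for y
  proof (cases "\<exists>g \<in> K. f g = y")
    case True
    then obtain g where g: "g \<in> K" "f g = y" by blast
    have "inj_on (\<lambda>h. inv g \<otimes> h) {h \<in> K. f h = y}"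
      using g K.mem_carrier by (auto intro!: inj_onI)
    moreover have "(\<lambda>h. inv g \<otimes> h) ` {h \<in> K. f h = y} \<subseteq> S" using fibre g by auto
    ultimately show ?thesis using S by (rule card_inj_on_le)
  next
    case False
    then have "{h \<in> K. f h = y} = {}" by auto
    then show ?thesis by (metis card.empty le0)
  qed
  have "card K \<le> card (\<Union>y\<in>Y. {h \<in> K. f h = y})"
    using f fin by (intro card_mono) auto
  also have "\<dots> \<le> (\<Sum>y\<in>Y. card {h \<in> K. f h = y})" by (rule card_UN_le[OF fin(2)])
  also have "\<dots> \<le> (\<Sum>y\<in>Y. card S)" by (intro sum_mono fibre_card)
  finally show ?thesis by simp
qed

text \<open>
  In other words, a subgroup of index at most 2 contains all squares: otherwise \<open>1\<close>, \<open>g\<close> and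
  \<open>g\<^sup>2\<close> represent three different cosets.
\<close>

lemma (in group) three_cosets_if_square_notin:
  assumes fin: "finite (carrier G)" and P: "subgroup P G" and g: "g \<in> carrier G" "g \<otimes> g \<notin> P"
  shows "3 * card P \<le> order G"
proof -
  interpret P: subgroup P G by fact
  have g1: "g \<notin> P" using g(2) P.m_closed by blast
  have mem: "x \<in> P #> x" if "x \<in> carrier G" for x using that P by (rule rcos_self)
  have notin: "x \<otimes> g \<notin> P #> x" if x: "x = \<one> \<or> x = g" for x
  proof
    assume "x \<otimes> g \<in> P #> x"
    then obtain p where p: "p \<in> P" "x \<otimes> g = p \<otimes> x" by (auto simp: r_coset_def)
    have pG: "p \<in> carrier G" using p(1) by (rule P.mem_carrier)
    from x have "g = p"
    proof
      assume "x = \<one>" then show ?thesis using p(2) g(1) pG by simp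
    next
      assume "x = g" then show ?thesis using p(2) g(1) pG by simp
    qed
    with p(1) g1 show False by blast
  qed
  have gg: "g \<otimes> g \<in> carrier G" using g(1) by simp
  have 1: "P #> g \<noteq> P #> \<one>" using notin[of \<one>] mem[OF g(1)] g(1) by force
  have 2: "P #> (g \<otimes> g) \<noteq> P #> g" using notin[of g] mem[OF gg] by force
  have 3: "P #> (g \<otimes> g) \<noteq> P #> \<one>"
    using mem[OF gg] g(2) coset_mult_one[OF P.subset] by force
  have "3 = card {P #> \<one>, P #> g, P #> (g \<otimes> g)}" using 1 2 3 by simp
  also have "\<dots> \<le> card (rcosets P)"
  proof (rule card_mono)
    show "finite (rcosets P)" using fin by (simp add: RCOSETS_def)
    show "{P #> \<one>, P #> g, P #> (g \<otimes> g)} \<subseteq> rcosets P"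
      using g(1) gg rcosetsI[OF P.subset] by blast
  qed
  finally have "3 \<le> card (rcosets P)" .
  then have "3 * card P \<le> card (rcosets P) * card P" by (rule mult_right_mono) simp
  then show ?thesis using lagrange[OF P] by simp
qed

lemma (in group) even_order_imp_involution:
  assumes "finite (carrier G)" "even (order G)"
  shows "\<exists>x \<in> carrier G. x \<noteq> \<one> \<and> x \<otimes> x = \<one>"
proof -
  obtain m where m: "order G = 2 ^ 1 * m" using assms(2) by auto
  obtain H where H: "subgroup H G" "card H = 2"
    using sylow_thm[OF two_is_prime_nat is_group m assms(1)] by auto
  obtain y z where "H = {y, z}" "y \<noteq> z" using H(2) by (auto simp: card_2_iff)
  then obtain x where x: "H = {\<one>, x}" "x \<noteq> \<one>"
    using subgroup.one_closed[OF H(1)] by blast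
  have xG: "x \<in> carrier G" using subgroup.mem_carrier[OF H(1)] x(1) by blast
  have "x \<otimes> x \<in> H" using subgroup.m_closed[OF H(1)] x(1) by blast
  then show ?thesis using x xG by auto
qed


section \<open>Actions and permutation degree\<close>

definition acts_on :: "('a, 'b) monoid_scheme \<Rightarrow> 'x set \<Rightarrow> ('a \<Rightarrow> 'x \<Rightarrow> 'x) \<Rightarrow> bool"
  where "acts_on G \<Omega> act \<longleftrightarrow>
    (\<forall>g \<in> carrier G. \<forall>x \<in> \<Omega>. act g x \<in> \<Omega>) \<and>
    (\<forall>x \<in> \<Omega>. act \<one>\<^bsub>G\<^esub> x = x) \<and>
    (\<forall>g \<in> carrier G. \<forall>h \<in> carrier G. \<forall>x \<in> \<Omega>. act (g \<otimes>\<^bsub>G\<^esub> h) x = act g (act h x))"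

text \<open>
  Numbering the points carries an action over to the standard symmetric group, whose points
  are the numbers from 1 up to the degree.
\<close>

lemma (in group) acts_on_imp_hom_sym_group:
  assumes fin: "finite \<Omega>" and act: "acts_on G \<Omega> act"
  obtains \<phi> where "\<phi> \<in> hom G (sym_group (card \<Omega>))"
    "kernel G (sym_group (card \<Omega>)) \<phi> = {g \<in> carrier G. \<forall>x \<in> \<Omega>. act g x = x}"
proof -
  obtain e where e: "bij_betw e {1..card \<Omega>} \<Omega>"
    using ex_bij_betw_nat_finite_1[OF fin] by blast
  let ?d = "inv_into {1..card \<Omega>} e"
  define \<phi> where "\<phi> g k = (if k \<in> {1..card \<Omega>} then ?d (act g (e k)) else k)" for g k
  have eX: "e k \<in> \<Omega>" if "k \<in> {1..card \<Omega>}" for k using e that by (rule bij_betwE[rule_format])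
  have d: "?d x \<in> {1..card \<Omega>}" "e (?d x) = x" if "x \<in> \<Omega>" for x
    using e that by (auto simp: bij_betw_def inv_into_into f_inv_into_f simp del: atLeastAtMost_iff)
  have de: "?d (e k) = k" if "k \<in> {1..card \<Omega>}" for k
    using e that by (simp add: bij_betw_def)
  have actX: "act g x \<in> \<Omega>" if "g \<in> carrier G" "x \<in> \<Omega>" for g x
    using act that by (simp add: acts_on_def)
  have comp: "\<phi> (g \<otimes> h) = \<phi> g \<circ> \<phi> h" if "g \<in> carrier G" "h \<in> carrier G" for g h
  proof
    fix k show "\<phi> (g \<otimes> h) k = (\<phi> g \<circ> \<phi> h) k"
      using act that d eX actX by (auto simp: \<phi>_def acts_on_def simp del: atLeastAtMost_iff)
  qed
  have one: "\<phi> \<one> = id"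
  proof
    fix k show "\<phi> \<one> k = id k"
      using act eX de by (auto simp: \<phi>_def acts_on_def simp del: atLeastAtMost_iff)
  qed
  have perm: "\<phi> g permutes {1..card \<Omega>}" if g: "g \<in> carrier G" for g
    unfolding permutes_def
  proof
    have "\<phi> g \<circ> \<phi> (inv g) = id" "\<phi> (inv g) \<circ> \<phi> g = id"
      using comp[of g "inv g"] comp[of "inv g" g] g one by simp_all
    then have "bij (\<phi> g)" using o_bij by blast
    then show "\<forall>k. \<exists>!l. \<phi> g l = k" by (simp add: bij_iff)
  qed (simp add: \<phi>_def)
  show ?thesis
  proof
    show "\<phi> \<in> hom G (sym_group (card \<Omega>))"
      using perm comp by (auto simp: hom_def sym_group_def)
    have "\<phi> g = id \<longleftrightarrow> (\<forall>x \<in> \<Omega>. act g x = x)" if g: "g \<in> carrier G" for g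
    proof
      assume id: "\<phi> g = id"
      show "\<forall>x \<in> \<Omega>. act g x = x"
      proof
        fix x assume x: "x \<in> \<Omega>"
        have "\<phi> g (?d x) = ?d x" using id by simp
        then have "?d (act g x) = ?d x" using d[OF x] by (simp add: \<phi>_def)
        then show "act g x = x" using d(2)[OF x] d(2)[OF actX[OF g x]] by metis
      qed
    next
      assume fixed: "\<forall>x \<in> \<Omega>. act g x = x"
      show "\<phi> g = id"
      proof
        fix k show "\<phi> g k = id k"
          using fixed eX de by (auto simp: \<phi>_def simp del: atLeastAtMost_iff)
      qed
    qed
    then show "kernel G (sym_group (card \<Omega>)) \<phi> = {g \<in> carrier G. \<forall>x \<in> \<Omega>. act g x = x}"
      by (auto simp: kernel_def sym_group_def)
  qed
qed

lemma (in group) mon_sym_group_if_faithful_action: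
  assumes "finite \<Omega>" "acts_on G \<Omega> act"
    and "\<And>g. \<lbrakk>g \<in> carrier G; \<forall>x \<in> \<Omega>. act g x = x\<rbrakk> \<Longrightarrow> g = \<one>"
  shows "mon G (sym_group (card \<Omega>)) \<noteq> {}"
proof -
  obtain \<phi> where \<phi>: "\<phi> \<in> hom G (sym_group (card \<Omega>))"
    "kernel G (sym_group (card \<Omega>)) \<phi> = {g \<in> carrier G. \<forall>x \<in> \<Omega>. act g x = x}"
    using acts_on_imp_hom_sym_group[OF assms(1,2)] by blast
  interpret group_hom G "sym_group (card \<Omega>)" \<phi>
    using \<phi>(1) sym_group_is_group by (simp add: group_hom_def group_hom_axioms_def)
  have "kernel G (sym_group (card \<Omega>)) \<phi> = {\<one>}"
    using assms(2,3) by (auto simp: \<phi>(2) acts_on_def)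
  then show ?thesis using \<phi>(1) trivial_ker_imp_inj unfolding mon_def by blast
qed

lemma (in group) action_kernel_quotient:
  assumes "finite \<Omega>" "acts_on G \<Omega> act"
    and N: "N = {g \<in> carrier G. \<forall>x \<in> \<Omega>. act g x = x}"
  shows "N \<lhd> G" and "mon (G Mod N) (sym_group (card \<Omega>)) \<noteq> {}"
proof -
  obtain \<phi> where \<phi>: "\<phi> \<in> hom G (sym_group (card \<Omega>))"
    "kernel G (sym_group (card \<Omega>)) \<phi> = N"
    unfolding N using acts_on_imp_hom_sym_group[OF assms(1,2)] by blast
  interpret group_hom G "sym_group (card \<Omega>)" \<phi>
    using \<phi>(1) sym_group_is_group by (simp add: group_hom_def group_hom_axioms_def)
  show "N \<lhd> G" using normal_kernel \<phi>(2) by simp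
  show "mon (G Mod N) (sym_group (card \<Omega>)) \<noteq> {}"
    using FactGroup_hom FactGroup_inj_on unfolding \<phi>(2) by (auto simp: mon_def)
qed

lemma acts_on_DirProd:
  assumes "acts_on G \<Omega> act" "acts_on H \<Omega>' act'"
  shows "acts_on (G \<times>\<times> H) (Inl ` \<Omega> \<union> Inr ` \<Omega>') (\<lambda>(g, h). map_sum (act g) (act' h))"
  using assms by (auto simp: acts_on_def)

lemma (in group) acts_on_lcosets:
  assumes "subgroup W G"
  shows "acts_on G (lcosets W) (\<lambda>g C. g <# C)"
  unfolding acts_on_def
proof (intro conjI ballI)
  have WG: "W \<subseteq> carrier G" using assms by (rule subgroup.subset)
  fix C assume "C \<in> lcosets W"
  then obtain x where x: "x \<in> carrier G" "C = x <# W" by (auto simp: LCOSETS_def)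
  then have CG: "C \<subseteq> carrier G" using WG l_coset_subset_G by blast
  show "\<one> <# C = C" using CG by (rule lcos_mult_one)
  fix g assume g: "g \<in> carrier G"
  show "g <# C \<in> lcosets W" using x g WG by (auto simp: lcos_m_assoc LCOSETS_def)
  fix h assume h: "h \<in> carrier G"
  show "(g \<otimes> h) <# C = g <# (h <# C)" using g h CG by (simp add: lcos_m_assoc)
qed

text \<open>
  The orbit of \<open>s\<close> has at most \<open>m\<close> points, and the elements that send \<open>s\<close> to a given point lie
  in one coset of its stabiliser.
\<close>

lemma (in group) order_le_degree_times_stabilizer:
  assumes fin: "finite (carrier G)" and \<phi>: "\<phi> \<in> hom G (sym_group m)" and s: "s \<in> {1..m}"
  shows "subgroup {g \<in> carrier G. \<phi> g s = s} G"
    and "order G \<le> m * card {g \<in> carrier G. \<phi> g s = s}"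
proof -
  let ?S = "{g \<in> carrier G. \<phi> g s = s}"
  interpret \<phi>: group_hom G "sym_group m" \<phi>
    using \<phi> sym_group_is_group by (simp add: group_hom_def group_hom_axioms_def)
  have perm: "\<phi> g permutes {1..m}" if "g \<in> carrier G" for g
    using \<phi>.hom_closed[OF that] by (simp add: sym_group_carrier)
  have mult: "\<phi> (g \<otimes> h) t = \<phi> g (\<phi> h t)" if "g \<in> carrier G" "h \<in> carrier G" for g h t
    using that by (simp add: sym_group_mult)
  have one: "\<phi> \<one> t = t" for t using \<phi>.hom_one by (simp add: sym_group_one)
  have cancel: "\<phi> (inv g) (\<phi> g t) = t" if "g \<in> carrier G" for g t
    using mult[of "inv g" g t] that one by simp
  show "subgroup ?S G"
  proof (rule subgroupI)
    show "?S \<noteq> {}" using one[of s] by blast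
    fix g assume g: "g \<in> ?S"
    then show "inv g \<in> ?S" using cancel[of g s] by simp
    fix h assume "h \<in> ?S"
    with g show "g \<otimes> h \<in> ?S" by (simp add: sym_group_mult)
  qed blast
  have "card (carrier G) \<le> card {1..m} * card ?S"
  proof (rule subgroup_card_le_by_fibres[where f = "\<lambda>g. \<phi> g s"])
    show "(\<lambda>g. \<phi> g s) ` carrier G \<subseteq> {1..m}"
      unfolding image_subset_iff using s permutes_in_image[OF perm] by blast
    fix g h assume "g \<in> carrier G" "h \<in> carrier G" "\<phi> g s = \<phi> h s"
    then show "inv g \<otimes> h \<in> ?S" using cancel[of g s] by (simp add: sym_group_mult)
  qed (simp_all add: fin subgroup_self)
  then show "order G \<le> m * card ?S" by (simp add: order_def)
qed


section \<open>The binary octahedral group has order 48\<close>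

lemmas quat_simps = quat_i_def quat_j_def quat_k_def quat_omega_def quat_gamma_def
  zero_quat_def one_quat_def uminus_quat_def times_quat_def

lemma quat_mult_group_pow [simp]: "x [^]\<^bsub>quat_mult_group\<^esub> (n :: nat) = x ^ n"
proof -
  interpret group quat_mult_group by (rule group_quat_mult_group)
  show ?thesis by (induction n) (simp_all add: power_Suc2 del: power_Suc)
qed

lemma Q8_subset: "Q8 \<subseteq> carrier quat_mult_group"
  by (auto simp: Q8_def quat_simps)

lemma Q8_mult: "\<lbrakk>x \<in> Q8; y \<in> Q8\<rbrakk> \<Longrightarrow> x * y \<in> Q8"
  unfolding Q8_def by (elim insertE; simp add: quat_simps)

lemma subgroup_Q8: "subgroup Q8 quat_mult_group"
proof (rule group.finite_closed_subgroup[OF group_quat_mult_group])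
  show "finite Q8" "\<one>\<^bsub>quat_mult_group\<^esub> \<in> Q8" by (simp_all add: Q8_def)
qed (use Q8_subset Q8_mult in auto)

lemma card_Q8: "card Q8 = 8"
  by (simp add: Q8_def quat_simps)

text \<open>
  Consequently a subgroup that avoids \<open>-1\<close> meets \<open>Q\<^sub>8\<close> trivially.
\<close>

lemma Q8_powers:
  assumes "x \<in> Q8"
  shows "x = 1 \<or> x = - 1 \<or> x * x = - 1"
  using assms unfolding Q8_def by (elim insertE) (simp_all add: quat_units_mult)

lemma omega_gamma_nonzero: "quat_omega \<noteq> 0" "quat_gamma \<noteq> 0"
  by (simp_all add: quat_simps)

lemma omega_cubed: "quat_omega ^ 3 = 1"
  by (simp add: numeral_eq_Suc quat_simps)

lemma gamma_squared: "quat_gamma * quat_gamma = quat_i"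
  by (simp add: quat_simps field_simps)

lemma Q8_omega: "q \<in> Q8 \<Longrightarrow> \<exists>q'\<in>Q8. q * quat_omega = quat_omega * q'"
  unfolding Q8_def by (elim insertE; simp add: quat_simps)

lemma Q8_gamma: "q \<in> Q8 \<Longrightarrow> \<exists>q'\<in>Q8. q * quat_gamma = quat_gamma * q'"
  unfolding Q8_def by (elim insertE; simp add: quat_simps)

lemma omega_Q8: "q \<in> Q8 \<Longrightarrow> \<exists>q'\<in>Q8. quat_omega * q = q' * quat_omega"
  unfolding Q8_def by (elim insertE; simp add: quat_simps)

lemma gamma_Q8: "q \<in> Q8 \<Longrightarrow> \<exists>q'\<in>Q8. quat_gamma * q = q' * quat_gamma"
  unfolding Q8_def by (elim insertE; simp add: quat_simps)

text \<open>
  The relation behind the normality of the binary tetrahedral group: modulo \<open>Q\<^sub>8\<close>, conjugation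
  by \<open>\<gamma>\<close> inverts \<open>\<omega>\<close>.
\<close>

lemma omega_gamma: "quat_omega * quat_gamma = quat_gamma * (quat_omega * quat_omega * - quat_i)"
  by (simp add: quat_simps field_simps)

lemma carrier_binary_tetrahedral:
  "carrier binary_tetrahedral = (\<lambda>(k, q). quat_omega ^ k * q) ` ({..<3} \<times> Q8)"
  and card_binary_tetrahedral: "card (carrier binary_tetrahedral) = 24"
proof -
  interpret group quat_mult_group by (rule group_quat_mult_group)
  have "carrier binary_tetrahedral = generate quat_mult_group (insert quat_omega Q8)"
    using Q8_subset omega_gamma_nonzero
    by (simp add: binary_tetrahedral_def carrier_subgroup_generated Int_absorb1)
  moreover have "generate quat_mult_group (insert quat_omega Q8)
      = (\<lambda>(k, q). quat_omega [^]\<^bsub>quat_mult_group\<^esub> k \<otimes>\<^bsub>quat_mult_group\<^esub> q) ` ({..<3 :: nat} \<times> Q8)"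
    and "card (generate quat_mult_group (insert quat_omega Q8)) = 3 * card Q8"
  proof (rule_tac [!] cyclic_extension)
    have "\<not> quat_omega ^ k \<in> Q8" if "0 < k" "k < 3" for k
    proof -
      have "k = 1 \<or> k = 2" using that by auto
      then show ?thesis by (auto simp: power2_eq_square Q8_def quat_simps)
    qed
    then show "quat_omega [^]\<^bsub>quat_mult_group\<^esub> k \<notin> Q8" if "0 < k" "k < 3" for k :: nat
      using that by simp
    then show "quat_omega [^]\<^bsub>quat_mult_group\<^esub> k \<notin> Q8" if "0 < k" "k < 3" for k :: nat
      using that by simp
  qed (use subgroup_Q8 omega_gamma_nonzero Q8_omega omega_cubed in \<open>auto simp: Q8_def\<close>)
  ultimately show "carrier binary_tetrahedral = (\<lambda>(k, q). quat_omega ^ k * q) ` ({..<3} \<times> Q8)"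
    and "card (carrier binary_tetrahedral) = 24"
    by (simp_all add: card_Q8)
qed

lemma carrier_binary_octahedral_eq:
  "carrier binary_octahedral = (\<lambda>(k, t). quat_gamma ^ k * t) ` ({..<2} \<times> carrier binary_tetrahedral)"
  and card_binary_octahedral: "card (carrier binary_octahedral) = 48"
proof -
  interpret group quat_mult_group by (rule group_quat_mult_group)
  let ?T = "carrier binary_tetrahedral"
  have T: "subgroup ?T quat_mult_group"
    unfolding binary_tetrahedral_def by (rule subgroup_subgroup_generated)
  have T_mult: "x * y \<in> ?T" if "x \<in> ?T" "y \<in> ?T" for x y
    using subgroup.m_closed[OF T that] by simp
  have omega_T: "quat_omega ^ k * q \<in> ?T" if "k < 3" "q \<in> Q8" for k q
    using that by (auto simp: carrier_binary_tetrahedral)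
  have Q8_T: "q \<in> ?T" if "q \<in> Q8" for q using omega_T[of 0 q] that by simp
  \<comment> \<open>the conjugate \<open>\<gamma>\<^sup>-\<^sup>1 \<omega> \<gamma>\<close>\<close>
  let ?t = "quat_omega * quat_omega * - quat_i"
  have t: "?t \<in> ?T" using omega_T[of 2 "- quat_i"] by (simp add: Q8_def power2_eq_square)
  have t_pow: "?t ^ k \<in> ?T" for k
  proof (induction k)
    case 0 show ?case using Q8_T[of 1] by (simp add: Q8_def)
  next
    case (Suc k) show ?case using T_mult[OF t Suc] by (simp only: power_Suc)
  qed
  have omega_pow_gamma: "quat_omega ^ k * quat_gamma = quat_gamma * ?t ^ k" for k
  proof (induction k)
    case (Suc k)
    have "quat_omega ^ Suc k * quat_gamma = quat_omega * (quat_omega ^ k * quat_gamma)"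
      by (simp add: mult.assoc)
    also have "\<dots> = (quat_omega * quat_gamma) * ?t ^ k" by (simp only: Suc mult.assoc)
    also have "\<dots> = quat_gamma * ?t ^ Suc k" by (simp only: omega_gamma mult.assoc power_Suc)
    finally show ?case .
  qed simp
  have normal: "\<exists>a'\<in>?T. a * quat_gamma = quat_gamma * a'" if "a \<in> ?T" for a
  proof -
    obtain k q where a: "q \<in> Q8" "a = quat_omega ^ k * q"
      using \<open>a \<in> ?T\<close> by (auto simp: carrier_binary_tetrahedral)
    obtain q' where q': "q' \<in> Q8" "q * quat_gamma = quat_gamma * q'" using Q8_gamma a by blast
    have "a * quat_gamma = (quat_omega ^ k * quat_gamma) * q'" by (simp only: a q' mult.assoc)
    also have "\<dots> = quat_gamma * (?t ^ k * q')" by (simp only: omega_pow_gamma mult.assoc)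
    finally show ?thesis using T_mult t_pow Q8_T q'(1) by blast
  qed
  have gamma: "quat_gamma \<notin> ?T"
  proof
    assume "quat_gamma \<in> ?T"
    then obtain k q where k: "k < 3" and q: "q \<in> Q8" and eq: "quat_gamma = quat_omega ^ k * q"
      by (auto simp: carrier_binary_tetrahedral)
    from k have "k = 0 \<or> k = 1 \<or> k = 2" by auto
    with q eq show False
      unfolding Q8_def by (elim disjE insertE) (auto simp: power2_eq_square quat_simps)
  qed
  have "carrier binary_octahedral = generate quat_mult_group (insert quat_gamma ?T)"
    using subgroup.subset[OF T] omega_gamma_nonzero
    by (simp add: binary_octahedral_def carrier_subgroup_generated Int_absorb1)
  moreover have "generate quat_mult_group (insert quat_gamma ?T)
      = (\<lambda>(k, t). quat_gamma [^]\<^bsub>quat_mult_group\<^esub> k \<otimes>\<^bsub>quat_mult_group\<^esub> t) ` ({..<2 :: nat} \<times> ?T)"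
    and "card (generate quat_mult_group (insert quat_gamma ?T)) = 2 * card ?T"
  proof (rule_tac [!] cyclic_extension)
    show "finite ?T" by (rule card_ge_0_finite) (simp add: card_binary_tetrahedral)
    then show "finite ?T" .
    show "quat_gamma [^]\<^bsub>quat_mult_group\<^esub> (2 :: nat) \<in> ?T"
      using Q8_T[of quat_i] by (simp add: power2_eq_square gamma_squared Q8_def)
    then show "quat_gamma [^]\<^bsub>quat_mult_group\<^esub> (2 :: nat) \<in> ?T" .
    show "quat_gamma [^]\<^bsub>quat_mult_group\<^esub> k \<notin> ?T" if "0 < k" "k < 2" for k :: nat
    proof -
      have "k = 1" using that by simp
      then show ?thesis using gamma by simp
    qed
    then show "quat_gamma [^]\<^bsub>quat_mult_group\<^esub> k \<notin> ?T" if "0 < k" "k < 2" for k :: nat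
      using that .
  qed (simp_all add: T omega_gamma_nonzero normal)
  ultimately show "carrier binary_octahedral = (\<lambda>(k, t). quat_gamma ^ k * t) ` ({..<2} \<times> ?T)"
    and "card (carrier binary_octahedral) = 48"
    by (simp_all add: card_binary_tetrahedral)
qed


section \<open>Subgroups of the binary octahedral group avoiding the central involution\<close>

lemma finite_binary_octahedral: "finite (carrier binary_octahedral)"
  by (rule card_ge_0_finite) (simp add: card_binary_octahedral)

lemma one_binary_octahedral [simp]: "\<one>\<^bsub>binary_octahedral\<^esub> = 1"
  by (simp add: binary_octahedral_def)

lemma binary_octahedral_nonzero: "x \<in> carrier binary_octahedral \<Longrightarrow> x \<noteq> 0"
  using group.carrier_subgroup_generated_subset[OF group_quat_mult_group]
  by (fastforce simp: binary_octahedral_def)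

lemma inv_binary_octahedral [simp]:
  assumes "x \<in> carrier binary_octahedral"
  shows "inv\<^bsub>binary_octahedral\<^esub> x = inverse x"
proof -
  interpret group binary_octahedral by (rule group_binary_octahedral)
  have "inv\<^bsub>binary_octahedral\<^esub> x * x = 1" using l_inv[OF assms] by simp
  then show ?thesis using binary_octahedral_nonzero[OF assms]
    by (metis inverse_unique inverse_inverse_eq nonzero_inverse_eq_imp_eq right_inverse left_inverse mult.assoc mult_1_left mult_1_right)
qed

lemma omega_gamma_in_binary_octahedral:
  "quat_omega \<in> carrier binary_octahedral" "quat_gamma \<in> carrier binary_octahedral"
  unfolding carrier_binary_octahedral by (auto intro: generate.incl)

lemma minus_one_in_binary_octahedral: "- 1 \<in> carrier binary_octahedral"
  using group_centre_binary_octahedral by (auto simp: group_centre_def)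

lemma Q8_normal_in_binary_octahedral:
  assumes x: "x \<in> carrier binary_octahedral" and q: "q \<in> Q8"
  shows "\<exists>q'\<in>Q8. x * q = q' * x"
proof -
  define normalises where "normalises y \<longleftrightarrow> (\<forall>q\<in>Q8. \<exists>q'\<in>Q8. y * q = q' * y)" for y
  have mult: "normalises (y * z)" if y: "normalises y" and z: "normalises z" for y z
    unfolding normalises_def
  proof
    fix q assume "q \<in> Q8"
    then obtain q1 where q1: "q1 \<in> Q8" "z * q = q1 * z" using z by (auto simp: normalises_def)
    then obtain q2 where q2: "q2 \<in> Q8" "y * q1 = q2 * y" using y by (auto simp: normalises_def)
    have "y * z * q = q2 * (y * z)" using q1(2) q2(2) by (metis mult.assoc)
    with q2(1) show "\<exists>q'\<in>Q8. y * z * q = q' * (y * z)" by blast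
  qed
  have pow: "normalises (y ^ k)" if "normalises y" for y k
  proof (induction k)
    case 0 show ?case by (simp add: normalises_def)
  next
    case (Suc k) show ?case using mult[OF that Suc] by simp
  qed
  have Q8: "normalises y" if y: "y \<in> Q8" for y
    unfolding normalises_def
  proof
    fix q assume "q \<in> Q8"
    have "y \<noteq> 0" using y Q8_subset by auto
    moreover have "inverse y \<in> Q8"
      using y unfolding Q8_def by (elim insertE) (simp_all add: quat_simps inverse_quat_def)
    ultimately show "\<exists>q'\<in>Q8. y * q = q' * y"
      using y \<open>q \<in> Q8\<close> by (intro bexI[of _ "y * q * inverse y"] Q8_mult) (simp_all add: mult.assoc)
  qed
  obtain k l r where "r \<in> Q8" "x = quat_gamma ^ k * (quat_omega ^ l * r)"
    using x by (auto simp: carrier_binary_octahedral_eq carrier_binary_tetrahedral)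
  moreover have "normalises quat_omega" "normalises quat_gamma"
    using omega_Q8 gamma_Q8 by (auto simp: normalises_def)
  ultimately have "normalises x" by (simp only: mult pow Q8)
  with q show ?thesis by (simp add: normalises_def)
qed

text \<open>
  In a division ring \<open>x\<^sup>2 = 1\<close> forces \<open>x = 1\<close> or \<open>x = -1\<close>, so such a subgroup has no involution and
  therefore odd order; and the odd divisors of \<open>48 = 2\<^sup>4 * 3\<close> are 1 and 3.
\<close>

lemma card_le_3_if_minus_one_notin:
  assumes A: "subgroup A binary_octahedral" and neg: "- 1 \<notin> A"
  shows "card A \<le> 3"
proof -
  interpret group binary_octahedral by (rule group_binary_octahedral)
  have "odd (card A)"
  proof
    assume "even (card A)"
    moreover have "finite A" using A finite_binary_octahedral by (metis subgroup.subset finite_subset)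
    ultimately obtain x where "x \<in> A" "x \<noteq> 1" "x * x = 1"
      using group.even_order_imp_involution[OF subgroup_imp_group[OF A]]
      by (auto simp: order_def)
    then have "x = - 1" by (simp add: square_eq_1_iff)
    with \<open>x \<in> A\<close> neg show False by blast
  qed
  then have "coprime (card A) (2 ^ 4)"
    by (simp only: coprime_power_right_iff coprime_right_2_iff_odd simp_thms)
  moreover have "card A dvd 2 ^ 4 * 3"
    using dvd_triv_right[of "card A" "card (rcosets\<^bsub>binary_octahedral\<^esub> A)"] lagrange[OF A]
    by (simp add: order_def card_binary_octahedral)
  ultimately have "card A dvd 3" by (simp only: coprime_dvd_mult_right_iff)
  then show ?thesis by (rule dvd_imp_le) simp
qed

text \<open>
  Such a subgroup has index less than 3 and so contains the square \<open>i = \<gamma>\<^sup>2\<close> and its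
  conjugate \<open>j\<close>.
\<close>

lemma i_j_in_subgroup_if_card_gt_16:
  assumes P: "subgroup P binary_octahedral" and big: "card P > 16"
  shows "quat_i \<in> P" "quat_j \<in> P"
proof -
  interpret group binary_octahedral by (rule group_binary_octahedral)
  have square: "g * g \<in> P" if "g \<in> carrier binary_octahedral" for g
    using three_cosets_if_square_notin[OF finite_binary_octahedral P that] big
    by (auto simp: order_def card_binary_octahedral)
  show "quat_i \<in> P" using square[OF omega_gamma_in_binary_octahedral(2)] by (simp add: gamma_squared)
  \<comment> \<open>the conjugate of \<open>\<gamma>\<close> by the inverse \<open>\<omega>\<^sup>2\<close> of \<open>\<omega>\<close>\<close>
  let ?g = "quat_omega * quat_omega * quat_gamma * quat_omega"
  have "?g \<in> carrier binary_octahedral"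
    using omega_gamma_in_binary_octahedral m_closed by simp
  moreover have "?g * ?g = quat_j" by (simp add: quat_simps field_simps)
  ultimately show "quat_j \<in> P" using square by metis
qed

text \<open>
  If \<open>P\<close> were larger, it would contain \<open>i\<close> and \<open>j\<close>. The commutator of either with an element
  of \<open>B\<close> lies in \<open>B\<close> because \<open>P\<close> normalises \<open>B\<close>, and in \<open>Q\<^sub>8\<close> because \<open>Q\<^sub>8\<close> is normal, hence is 1.
  But a quaternion that commutes with \<open>i\<close> and \<open>j\<close> is real.
\<close>

lemma normaliser_card_le_16:
  assumes P: "subgroup P binary_octahedral" and B: "subgroup B binary_octahedral"
    and neg: "- 1 \<notin> B" and nontrivial: "B \<noteq> {1}"
    and normal: "\<And>x b. \<lbrakk>x \<in> P; b \<in> B\<rbrakk> \<Longrightarrow> x * b * inverse x \<in> B"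
  shows "card P \<le> 16"
proof (rule ccontr)
  interpret group binary_octahedral by (rule group_binary_octahedral)
  assume "\<not> card P \<le> 16"
  then have ij: "quat_i \<in> P" "quat_j \<in> P" using i_j_in_subgroup_if_card_gt_16[OF P] by auto
  have B_mult: "x * y \<in> B" if "x \<in> B" "y \<in> B" for x y using subgroup.m_closed[OF B that] by simp
  have Q8_Int_B: "x = 1" if x: "x \<in> Q8" "x \<in> B" for x
    using Q8_powers[OF x(1)] B_mult[OF x(2) x(2)] x neg by auto
  have commute: "x * b = b * x" if x: "x \<in> Q8" "x \<in> P" and b: "b \<in> B" for x b
  proof -
    have bO: "b \<in> carrier binary_octahedral" using b by (rule subgroup.mem_carrier[OF B])
    then have nz: "b \<noteq> 0" "x \<noteq> 0" using binary_octahedral_nonzero x(1) Q8_subset by auto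
    have "inverse x \<in> Q8"
      using x(1) unfolding Q8_def by (elim insertE) (simp_all add: quat_simps inverse_quat_def)
    then obtain q where q: "q \<in> Q8" "b * inverse x = q * b"
      using Q8_normal_in_binary_octahedral[OF bO] by blast
    have "inverse b \<in> B" using subgroup.m_inv_closed[OF B b] bO by simp
    then have "x * b * inverse x * inverse b \<in> B" using B_mult normal x(2) b by blast
    moreover have "x * b * inverse x * inverse b = x * q"
      using q(2) nz by (simp add: mult.assoc)
    ultimately have "x * b * inverse x * inverse b = 1" using Q8_Int_B Q8_mult x(1) q(1) by auto
    then show ?thesis using nz
      by (metis (no_types, lifting) left_inverse mult.assoc mult_1_left mult_1_right)
  qed
  obtain b where b: "b \<in> B" "b \<noteq> 1" using nontrivial subgroup.one_closed[OF B] by auto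
  have bO: "b \<in> carrier binary_octahedral" using b(1) by (rule subgroup.mem_carrier[OF B])
  have "quat_i * b = b * quat_i" "quat_j * b = b * quat_j"
    using commute ij b(1) by (auto simp: Q8_def)
  then have "qI b = 0" "qJ b = 0" "qK b = 0" by (simp_all add: quat_simps)
  then have "b \<in> group_centre binary_octahedral"
    using bO by (auto simp: group_centre_def times_quat_def)
  then show False using b neg by (auto simp: group_centre_binary_octahedral)
qed


text \<open>
  The hypotheses say that \<open>K\<close> is the preimage of a subgroup of the central square that misses
  the central involution. The bound is attained, for example by the diagonal.
\<close>

lemma subgroup_product_card_le_48:
  assumes K: "subgroup K (binary_octahedral \<times>\<times> binary_octahedral)"
    and diag: "(- 1, - 1) \<in> K" and neg: "(1, - 1) \<notin> K"
  shows "card K \<le> 48"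
proof -
  let ?O = "binary_octahedral" and ?D = "binary_octahedral \<times>\<times> binary_octahedral"
  interpret O: group ?O by (rule group_binary_octahedral)
  interpret D: group ?D by (intro DirProd_group group_binary_octahedral)
  have KO: "x \<in> carrier ?O" "y \<in> carrier ?O" if "(x, y) \<in> K" for x y
    using subgroup.mem_carrier[OF K that] by simp_all
  have K_one: "(1, 1) \<in> K" using subgroup.one_closed[OF K] by simp
  have K_mult: "(x * x', y * y') \<in> K" if "(x, y) \<in> K" "(x', y') \<in> K" for x y x' y'
    using subgroup.m_closed[OF K that] by simp
  have K_inv: "(inverse x, inverse y) \<in> K" if "(x, y) \<in> K" for x y
    using subgroup.m_inv_closed[OF K that] KO[OF that] by (simp add: inv_DirProd O.is_group)
  have finK: "finite K"
    using subgroup.subset[OF K] finite_binary_octahedral by (auto intro: finite_subset)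
  define A where "A = {a. (a, 1) \<in> K}"
  define B where "B = {b. (1, b) \<in> K}"
  define P where "P = snd ` K"
  have A: "subgroup A ?O"
  proof (rule O.subgroupI)
    show "A \<subseteq> carrier ?O" using KO(1) by (auto simp: A_def)
    show "A \<noteq> {}" using K_one by (auto simp: A_def)
    fix a assume a: "a \<in> A"
    then show "inv\<^bsub>?O\<^esub> a \<in> A" using K_inv[of a 1] KO(1)[of a 1] by (simp add: A_def)
    fix a' assume "a' \<in> A"
    with a show "a \<otimes>\<^bsub>?O\<^esub> a' \<in> A" using K_mult[of a 1 a' 1] by (simp add: A_def)
  qed
  have B: "subgroup B ?O"
  proof (rule O.subgroupI)
    show "B \<subseteq> carrier ?O" using KO(2) by (auto simp: B_def)
    show "B \<noteq> {}" using K_one by (auto simp: B_def)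
    fix b assume b: "b \<in> B"
    then show "inv\<^bsub>?O\<^esub> b \<in> B" using K_inv[of 1 b] KO(2)[of 1 b] by (simp add: B_def)
    fix b' assume "b' \<in> B"
    with b show "b \<otimes>\<^bsub>?O\<^esub> b' \<in> B" using K_mult[of 1 b 1 b'] by (simp add: B_def)
  qed
  have P_I: "y \<in> P" if "(x, y) \<in> K" for x y using that by (force simp: P_def)
  have P: "subgroup P ?O"
  proof (rule O.subgroupI)
    show "P \<subseteq> carrier ?O" using KO(2) by (auto simp: P_def)
    show "P \<noteq> {}" using K_one by (auto simp: P_def)
    fix y assume "y \<in> P"
    then obtain x where x: "(x, y) \<in> K" by (auto simp: P_def)
    then show "inv\<^bsub>?O\<^esub> y \<in> P" using P_I[OF K_inv[OF x]] KO(2)[OF x] by simp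
    fix y' assume "y' \<in> P"
    then obtain x' where "(x', y') \<in> K" by (auto simp: P_def)
    then show "y \<otimes>\<^bsub>?O\<^esub> y' \<in> P" using P_I[OF K_mult[OF x]] by simp
  qed
  have fin: "finite A" "finite B" "finite P"
    using A B P by (simp_all add: finite_subset[OF subgroup.subset finite_binary_octahedral])
  \<comment> \<open>\<open>(-1, 1)\<close> is the product of \<open>(1, -1)\<close> and \<open>(-1, -1)\<close>\<close>
  have neg_A: "- 1 \<notin> A"
    using K_mult[OF _ diag, of "- 1" 1] neg by (auto simp: A_def)
  have neg_B: "- 1 \<notin> B" using neg by (simp add: B_def)
  have fst_le: "card K \<le> card (fst ` K) * card B"
  proof -
    have "card K \<le> card (fst ` K) * card ((\<lambda>b. (1 :: quat, b)) ` B)"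
    proof (rule D.subgroup_card_le_by_fibres[OF K])
      fix g h assume gh: "g \<in> K" "h \<in> K" "fst g = fst h"
      then obtain x y z where "g = (x, y)" "h = (x, z)" by (cases g; cases h) simp
      then show "inv\<^bsub>?D\<^esub> g \<otimes>\<^bsub>?D\<^esub> h \<in> (\<lambda>b. (1, b)) ` B"
        using gh KO[of x y] K_mult[OF K_inv, of x y x z] binary_octahedral_nonzero[of x]
        by (simp add: B_def O.is_group image_iff)
    qed (use finK fin in auto)
    also have "card ((\<lambda>b. (1 :: quat, b)) ` B) = card B" by (rule card_image) (simp add: inj_on_def)
    finally show ?thesis .
  qed
  have snd_le: "card K \<le> card P * card A"
  proof -
    have "card K \<le> card P * card ((\<lambda>a. (a, 1 :: quat)) ` A)"
    proof (rule D.subgroup_card_le_by_fibres[OF K])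
      fix g h assume gh: "g \<in> K" "h \<in> K" "snd g = snd h"
      then obtain x y z where "g = (y, x)" "h = (z, x)" by (cases g; cases h) simp
      then show "inv\<^bsub>?D\<^esub> g \<otimes>\<^bsub>?D\<^esub> h \<in> (\<lambda>a. (a, 1)) ` A"
        using gh KO[of y x] K_mult[OF K_inv, of y x z x] binary_octahedral_nonzero[of x]
        by (simp add: A_def O.is_group image_iff)
    qed (use finK fin in \<open>auto simp: P_def\<close>)
    also have "card ((\<lambda>a. (a, 1 :: quat)) ` A) = card A" by (rule card_image) (simp add: inj_on_def)
    finally show ?thesis .
  qed
  show ?thesis
  proof (cases "B = {1}")
    case True
    have "fst ` K \<subseteq> carrier ?O" using KO by auto
    then have "card (fst ` K) \<le> 48"
      using card_mono[OF finite_binary_octahedral] card_binary_octahedral by metis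
    then show ?thesis using fst_le True by simp
  next
    case False
    have "card P \<le> 16"
    proof (rule normaliser_card_le_16[OF P B neg_B False])
      fix y b assume "y \<in> P" "b \<in> B"
      then obtain x where x: "(x, y) \<in> K" and b: "(1, b) \<in> K" by (auto simp: P_def B_def)
      have "(x * 1 * inverse x, y * b * inverse y) \<in> K" by (intro K_mult K_inv x b)
      then show "y * b * inverse y \<in> B"
        using binary_octahedral_nonzero[OF KO(1)[OF x]] by (simp add: B_def)
    qed
    moreover have "card A \<le> 3" using A neg_A by (rule card_le_3_if_minus_one_notin)
    ultimately have "card P * card A \<le> 16 * 3" by (rule mult_le_mono)
    then show ?thesis using snd_le by simp
  qed
qed


section \<open>The degrees of the direct and the central square\<close>

lemma left_right_multiplication_action:
  "acts_on (binary_octahedral \<times>\<times> binary_octahedral) (carrier binary_octahedral)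
    (\<lambda>(a, b) x. a * x * inverse b)"
proof -
  interpret O: group binary_octahedral by (rule group_binary_octahedral)
  have mult: "x * y \<in> carrier binary_octahedral"
    if "x \<in> carrier binary_octahedral" "y \<in> carrier binary_octahedral" for x y
    using O.m_closed[OF that] by simp
  have inv: "inverse x \<in> carrier binary_octahedral" if "x \<in> carrier binary_octahedral" for x
    using O.inv_closed[OF that] that by simp
  show ?thesis
    using mult inv binary_octahedral_nonzero
    by (auto simp: acts_on_def nonzero_inverse_mult_distrib mult.assoc)
qed

text \<open>
  A pair \<open>(a, b)\<close> that fixes the point 1 has \<open>a = b\<close>, and then fixing all points means that \<open>a\<close> is
  central.
\<close>

lemma left_right_multiplication_kernel:
  "{(z, z) | z. z \<in> group_centre binary_octahedral} =
    {g \<in> carrier (binary_octahedral \<times>\<times> binary_octahedral).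
      \<forall>x \<in> carrier binary_octahedral. (case g of (a, b) \<Rightarrow> \<lambda>x. a * x * inverse b) x = x}"
proof -
  let ?O = "binary_octahedral"
  interpret O: group ?O by (rule group_binary_octahedral)
  have one: "1 \<in> carrier ?O" using O.one_closed by simp
  have fixes_iff: "a * x * inverse b = x \<longleftrightarrow> a * x = x * b" if "b \<noteq> 0" for a x b :: quat
    using that by (metis left_inverse right_inverse mult.assoc mult_1_right)
  have "(\<forall>x \<in> carrier ?O. a * x * inverse b = x) \<longleftrightarrow> a = b \<and> a \<in> group_centre ?O"
    if "a \<in> carrier ?O" "b \<in> carrier ?O" for a b
  proof -
    have "(\<forall>x \<in> carrier ?O. a * x * inverse b = x) \<longleftrightarrow> (\<forall>x \<in> carrier ?O. a * x = x * b)"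
      using fixes_iff binary_octahedral_nonzero[OF that(2)] by simp
    also have "\<dots> \<longleftrightarrow> a = b \<and> a \<in> group_centre ?O"
    proof
      assume commute: "\<forall>x \<in> carrier ?O. a * x = x * b"
      then have "a = b" using bspec[OF commute one] by simp
      then show "a = b \<and> a \<in> group_centre ?O" using that commute by (simp add: group_centre_def)
    qed (auto simp: group_centre_def)
    finally show ?thesis .
  qed
  then show ?thesis by (auto simp: group_centre_def)
qed

lemma central_square_diagonal_normal:
  "{(z, z) | z. z \<in> group_centre binary_octahedral} \<lhd> binary_octahedral \<times>\<times> binary_octahedral"
  and central_square_embeds_in_sym_48:
  "mon (central_square binary_octahedral) (sym_group 48) \<noteq> {}"
proof -
  interpret D: group "binary_octahedral \<times>\<times> binary_octahedral"
    by (intro DirProd_group group_binary_octahedral)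
  note act = D.action_kernel_quotient[OF finite_binary_octahedral
      left_right_multiplication_action left_right_multiplication_kernel]
  show "{(z, z) | z. z \<in> group_centre binary_octahedral} \<lhd> binary_octahedral \<times>\<times> binary_octahedral"
    by (rule act(1))
  show "mon (central_square binary_octahedral) (sym_group 48) \<noteq> {}"
    using act(2) unfolding central_square_def card_binary_octahedral .
qed

text \<open>
  By faithfulness the class of \<open>(1, -1)\<close> moves some point. The preimage of the stabiliser of
  that point has at most 48 of the \<open>48 * 48\<close> elements.
\<close>

lemma central_square_degree_ge_48:
  assumes "mon (central_square binary_octahedral) (sym_group m) \<noteq> {}"
  shows "48 \<le> m"
proof -
  let ?O = "binary_octahedral" and ?D = "binary_octahedral \<times>\<times> binary_octahedral"
  let ?Z = "{(z, z) | z. z \<in> group_centre binary_octahedral}"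
  interpret O: group ?O by (rule group_binary_octahedral)
  interpret D: group ?D by (intro DirProd_group group_binary_octahedral)
  interpret Z: normal ?Z ?D by (rule central_square_diagonal_normal)
  obtain \<psi> where \<psi>: "\<psi> \<in> hom (?D Mod ?Z) (sym_group m)" "inj_on \<psi> (carrier (?D Mod ?Z))"
    using assms by (auto simp: mon_def central_square_def)
  define \<phi> where "\<phi> = \<psi> \<circ> (\<lambda>g. ?Z #>\<^bsub>?D\<^esub> g)"
  have \<phi>: "\<phi> \<in> hom ?D (sym_group m)"
    unfolding \<phi>_def by (rule hom_compose[OF Z.r_coset_hom_Mod \<psi>(1)])
  have \<psi>_Z: "\<psi> ?Z = id"
    using group_hom.hom_one[of "?D Mod ?Z" "sym_group m" \<psi>] \<psi>(1) Z.factorgroup_is_group sym_group_is_group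
    by (simp add: group_hom_def group_hom_axioms_def sym_group_one FactGroup_def)
  have one: "1 \<in> carrier ?O" using O.one_closed by simp
  note mem = one minus_one_in_binary_octahedral
  have "(1, - 1) \<notin> ?Z" by (auto simp: one_quat_def uminus_quat_def)
  have coset: "?Z #>\<^bsub>?D\<^esub> g = ?Z \<longleftrightarrow> g \<in> ?Z" if "g \<in> carrier ?D" for g
    using D.coset_join1[OF _ that Z.subgroup_axioms] D.coset_join2[OF that Z.subgroup_axioms] Z.subset by blast
  have "\<phi> (1, - 1) \<noteq> id"
  proof
    assume "\<phi> (1, - 1) = id"
    then have "\<psi> (?Z #>\<^bsub>?D\<^esub> (1, - 1)) = \<psi> ?Z" by (simp add: \<phi>_def \<psi>_Z)
    moreover have "?Z #>\<^bsub>?D\<^esub> (1, - 1) \<in> carrier (?D Mod ?Z)" "?Z \<in> carrier (?D Mod ?Z)"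
      using mem Z.subgroup_in_rcosets[OF D.is_group] by (auto simp: FactGroup_def RCOSETS_def)
    ultimately have "?Z #>\<^bsub>?D\<^esub> (1, - 1) = ?Z" using \<psi>(2) by (auto dest: inj_onD)
    then show False using coset mem \<open>(1, - 1) \<notin> ?Z\<close> by simp
  qed
  moreover have "\<phi> (1, - 1) permutes {1..m}"
    using \<phi> mem by (auto simp: hom_def sym_group_def)
  ultimately obtain s where s: "s \<in> {1..m}" "\<phi> (1, - 1) s \<noteq> s"
    unfolding permutes_def by (metis eq_id_iff)
  have "\<phi> (- 1, - 1) = id"
    using coset[of "(- 1, - 1)"] mem \<psi>_Z by (simp add: \<phi>_def group_centre_binary_octahedral)
  let ?K = "{g \<in> carrier ?D. \<phi> g s = s}"
  have finD: "finite (carrier ?D)" using finite_binary_octahedral by simp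
  have "card ?K \<le> 48"
  proof (rule subgroup_product_card_le_48)
    show "subgroup ?K ?D" by (rule D.order_le_degree_times_stabilizer(1)[OF finD \<phi> s(1)])
    show "(- 1, - 1) \<in> ?K" using mem \<open>\<phi> (- 1, - 1) = id\<close> by simp
    show "(1, - 1) \<notin> ?K" using s(2) by simp
  qed
  then have "m * card ?K \<le> m * 48" by (rule mult_le_mono2)
  moreover have "order ?D \<le> m * card ?K"
    by (rule D.order_le_degree_times_stabilizer(2)[OF finD \<phi> s(1)])
  moreover have "order ?D = 48 * 48"
    by (simp add: order_def card_cartesian_product card_binary_octahedral)
  ultimately show ?thesis by linarith
qed

lemma subgroup_omega: "subgroup {1, quat_omega, quat_omega * quat_omega} binary_octahedral"
proof -
  interpret O: group binary_octahedral by (rule group_binary_octahedral)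
  note w = omega_gamma_in_binary_octahedral(1)
  have "1 \<in> carrier binary_octahedral" using O.one_closed by simp
  moreover have "quat_omega * quat_omega \<in> carrier binary_octahedral" using O.m_closed[OF w w] by simp
  moreover have "quat_omega * (quat_omega * quat_omega) = 1"
    using omega_cubed by (simp add: power3_eq_cube mult.assoc)
  moreover from this have "quat_omega * (quat_omega * (quat_omega * x)) = x" for x
    by (metis mult.assoc mult_1_left)
  ultimately show ?thesis
    using w by (intro O.finite_closed_subgroup) (auto simp: mult.assoc)
qed

text \<open>
  An element that fixes all cosets of \<open>{1, \<omega>, \<omega>\<^sup>2}\<close> lies in all conjugates of this subgroup;
  already its conjugate by \<open>\<gamma>\<close> meets it only in 1. So \<open>O\<close> acts faithfully on \<open>48 / 3 = 16\<close>
  points, and \<open>O \<times> O\<close> on two disjoint copies of them.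
\<close>

lemma direct_square_embeds_in_sym_32:
  "mon (binary_octahedral \<times>\<times> binary_octahedral) (sym_group 32) \<noteq> {}"
proof -
  let ?O = "binary_octahedral" and ?D = "binary_octahedral \<times>\<times> binary_octahedral"
  let ?W = "{1, quat_omega, quat_omega * quat_omega}"
  interpret O: group ?O by (rule group_binary_octahedral)
  interpret D: group ?D by (intro DirProd_group group_binary_octahedral)
  let ?L = "lcosets\<^bsub>?O\<^esub> ?W"
  let ?\<Omega> = "Inl ` ?L \<union> Inr ` ?L"
  let ?act = "\<lambda>(a, b). map_sum (\<lambda>C. a <#\<^bsub>?O\<^esub> C) (\<lambda>C. b <#\<^bsub>?O\<^esub> C)"
  have fin: "finite ?L" using finite_binary_octahedral by (simp add: LCOSETS_def)
  have "card ?W = 3" by (simp add: quat_simps)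
  then have "card ?L = 16"
    using O.l_lagrange[OF finite_binary_octahedral subgroup_omega]
    by (simp add: order_def card_binary_octahedral)
  then have card: "card ?\<Omega> = 32"
    using fin by (subst card_Un_disjoint) (auto simp: card_image)
  have trivial: "a = 1" if a: "a \<in> carrier ?O" and fixed: "\<forall>C \<in> ?L. a <#\<^bsub>?O\<^esub> C = C" for a
  proof -
    have conj: "\<exists>w \<in> ?W. a * x = x * w" if x: "x \<in> carrier ?O" for x
    proof -
      have "x <#\<^bsub>?O\<^esub> ?W \<in> ?L" using x by (auto simp: LCOSETS_def)
      then have "a <#\<^bsub>?O\<^esub> (x <#\<^bsub>?O\<^esub> ?W) = x <#\<^bsub>?O\<^esub> ?W" using fixed by blast
      moreover have "a * x \<in> a <#\<^bsub>?O\<^esub> (x <#\<^bsub>?O\<^esub> ?W)" by (force simp: l_coset_def)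
      ultimately show ?thesis by (auto simp: l_coset_def)
    qed
    have "1 \<in> carrier ?O" using O.one_closed by simp
    then have "a \<in> ?W" using conj[of 1] by simp
    with conj[OF omega_gamma_in_binary_octahedral(2)] show "a = 1"
      by (elim insertE) (auto simp: quat_simps)
  qed
  have "mon ?D (sym_group (card ?\<Omega>)) \<noteq> {}"
  proof (rule D.mon_sym_group_if_faithful_action)
    show "acts_on ?D ?\<Omega> ?act"
      by (intro acts_on_DirProd O.acts_on_lcosets subgroup_omega)
    fix g assume g: "g \<in> carrier ?D" "\<forall>x \<in> ?\<Omega>. ?act g x = x"
    obtain a b where ab: "g = (a, b)" by (cases g)
    have "\<forall>C \<in> ?L. a <#\<^bsub>?O\<^esub> C = C" "\<forall>C \<in> ?L. b <#\<^bsub>?O\<^esub> C = C"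
      using g(2) by (simp_all add: ab ball_Un)
    then show "g = \<one>\<^bsub>?D\<^esub>" using trivial g(1) by (simp add: ab)
  qed (use fin in simp)
  then show ?thesis unfolding card .
qed

theorem proposition8p5:
  shows "exceptional (binary_octahedral \<times>\<times> binary_octahedral)
    \<and> distinguished_quotient (central_square binary_octahedral)
        (binary_octahedral \<times>\<times> binary_octahedral)
    \<and> min_perm_degree (central_square binary_octahedral) = 48"
proof -
  let ?D = "binary_octahedral \<times>\<times> binary_octahedral"
  let ?Z = "{(z, z) | z. z \<in> group_centre binary_octahedral}"
  have direct: "min_perm_degree ?D \<le> 32"
    unfolding min_perm_degree_def by (rule Least_le) (rule direct_square_embeds_in_sym_32)
  have central: "min_perm_degree (central_square binary_octahedral) = 48"
    unfolding min_perm_degree_def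
    by (rule Least_equality) (rule central_square_embeds_in_sym_48 central_square_degree_ge_48, assumption?)+
  have distinguished: "distinguished_subgroup ?Z ?D"
    using central_square_diagonal_normal direct central
    by (simp add: distinguished_subgroup_def central_square_def)
  moreover have "finite (carrier ?D)" using finite_binary_octahedral by simp
  ultimately have "exceptional ?D"
    unfolding exceptional_def using DirProd_group[OF group_binary_octahedral group_binary_octahedral] by blast
  moreover have "distinguished_quotient (central_square binary_octahedral) ?D"
    unfolding distinguished_quotient_def central_square_def using distinguished by blast
  ultimately show ?thesis using central by blast
qed

end
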